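(* For any graph $E$, the monoid $M(E)$ is a refinement monoid.
   Context: A graph is a directed graph $E=(E^0,E^1,s,r)$ with $E^0$ a nonempty set (no finiteness or countability assumptions; in particular vertices may emit infinitely many edges). $M(E)$ is the abelian monoid with generators $E^0\sqcup\{q'_Z\mid Z\subseteq s^{-1}(v),\ v\in E^0,\ 0<|Z|<\infty\}$ and relations, where $\mathbf r(Y):=\sum_{e\in Y}r(e)$ for finite $Y\subseteq E^1$: (1) $v=\mathbf r(Z)+q'_Z$ for $v\in E^0$ and nonempty finite $Z\subseteq s^{-1}(v)$; (2) $q'_{Z_1}=\mathbf r(Z_2\setminus Z_1)+q'_{Z_2}$ for finite nonempty subsets $Z_1\subsetneq Z_2$ of $s^{-1}(v)$, $v\in E^0$; (3) $q'_{s^{-1}(v)}=0$ for each $v\in E^0$ with $s^{-1}(v)$ nonempty and finite. (This is $M(E,C,S)$ for the trivial separation $C_v=\{s^{-1}(v)\}$ for non-sinks $v$, $C_v=\emptyset$ for sinks, and $S$ the set of all finite members of $C$.) An abelian monoid is a refinement monoid if whenever $a+b=c+d$ there exist $x,y,z,t$ with $a=x+y$, $b=z+t$, $c=x+z$, $d=y+t$. *)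

theory Defs
  imports "Graph_Theory.Digraph" "HOL-Algebra.Group" "HOL-Library.Multiset"
begin

section \<open>Refinement monoids\<close>

text \<open>Abelian monoids are HOL-Algebra commutative monoids, so the operation written
  \<open>+\<close> in the theory of graph monoids is \<open>\<otimes>\<close> here and \<open>0\<close> is \<open>\<one>\<close>.\<close>

locale refinement_monoid = comm_monoid M for M (structure) +
  assumes refinement:
    "\<lbrakk>a \<in> carrier M; b \<in> carrier M; c \<in> carrier M; d \<in> carrier M; a \<otimes> b = c \<otimes> d\<rbrakk> \<Longrightarrow>
      \<exists>x\<in>carrier M. \<exists>y\<in>carrier M. \<exists>z\<in>carrier M. \<exists>t\<in>carrier M.
        a = x \<otimes> y \<and> b = z \<otimes> t \<and> c = x \<otimes> z \<and> d = y \<otimes> t"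

section \<open>Abelian monoids given by generators and relations\<close>

text \<open>The free abelian monoid on \<open>X\<close> consists of the finite multisets of elements of \<open>X\<close>.\<close>

definition free_ab :: "'g set \<Rightarrow> 'g multiset set" where
  "free_ab X = {a. set_mset a \<subseteq> X}"

inductive_set pres_cong :: "'g set \<Rightarrow> ('g multiset \<times> 'g multiset) set \<Rightarrow> ('g multiset \<times> 'g multiset) set"
  for X :: "'g set" and R :: "('g multiset \<times> 'g multiset) set"
where
  base: "\<lbrakk>(a, b) \<in> R; a \<in> free_ab X; b \<in> free_ab X\<rbrakk> \<Longrightarrow> (a, b) \<in> pres_cong X R"
| refl: "a \<in> free_ab X \<Longrightarrow> (a, a) \<in> pres_cong X R"
| sym: "(a, b) \<in> pres_cong X R \<Longrightarrow> (b, a) \<in> pres_cong X R"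
| trans: "\<lbrakk>(a, b) \<in> pres_cong X R; (b, c) \<in> pres_cong X R\<rbrakk> \<Longrightarrow> (a, c) \<in> pres_cong X R"
| add: "\<lbrakk>(a, b) \<in> pres_cong X R; (c, d) \<in> pres_cong X R\<rbrakk> \<Longrightarrow> (a + c, b + d) \<in> pres_cong X R"

definition pres_monoid :: "'g set \<Rightarrow> ('g multiset \<times> 'g multiset) set \<Rightarrow> 'g multiset set monoid" where
  "pres_monoid X R =
    \<lparr>carrier = free_ab X // pres_cong X R,
     monoid.mult = (\<lambda>A B. \<Union>a\<in>A. \<Union>b\<in>B. pres_cong X R `` {a + b}),
     monoid.one = pres_cong X R `` {{#}}\<rparr>"

lemma pres_cong_free:
  "(a, b) \<in> pres_cong X R \<Longrightarrow> a \<in> free_ab X \<and> b \<in> free_ab X"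
  by (induction rule: pres_cong.induct) (auto simp: free_ab_def)

lemma equiv_pres_cong: "equiv (free_ab X) (pres_cong X R)"
proof (rule equivI)
  show "pres_cong X R \<subseteq> free_ab X \<times> free_ab X"
    using pres_cong_free by fastforce
  show "refl_on (free_ab X) (pres_cong X R)"
    by (simp add: refl_on_def pres_cong.refl)
  show "sym (pres_cong X R)"
    by (blast intro: symI pres_cong.sym)
  show "trans (pres_cong X R)"
    by (blast intro: transI pres_cong.trans)
qed

lemma pres_monoid_mult_class:
  assumes "a \<in> free_ab X" "b \<in> free_ab X"
  shows "(pres_cong X R `` {a}) \<otimes>\<^bsub>pres_monoid X R\<^esub> (pres_cong X R `` {b}) = pres_cong X R `` {a + b}"
proof -
  have "pres_cong X R `` {a' + b'} = pres_cong X R `` {a + b}"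
    if "a' \<in> pres_cong X R `` {a}" "b' \<in> pres_cong X R `` {b}" for a' b'
    using equiv_class_eq[OF equiv_pres_cong pres_cong.add, of a a' X R b b'] that by simp
  moreover have "a \<in> pres_cong X R `` {a}" "b \<in> pres_cong X R `` {b}"
    using assms by (auto intro: pres_cong.refl)
  ultimately have "(\<Union>a'\<in>pres_cong X R `` {a}. \<Union>b'\<in>pres_cong X R `` {b}. pres_cong X R `` {a' + b'})
      = pres_cong X R `` {a + b}"
    by (intro equalityI UN_least) blast+
  then show ?thesis
    by (simp add: pres_monoid_def)
qed

lemma comm_monoid_pres_monoid: "comm_monoid (pres_monoid X R)"
proof -
  let ?M = "pres_monoid X R"
  define cls where "cls a = pres_cong X R `` {a}" for a
  have mult: "cls a \<otimes>\<^bsub>?M\<^esub> cls b = cls (a + b)" if "a \<in> free_ab X" "b \<in> free_ab X" for a b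
    using that by (simp add: cls_def pres_monoid_mult_class)
  have carrier: "carrier ?M = cls ` free_ab X"
    by (auto simp: pres_monoid_def quotient_def cls_def)
  have one: "\<one>\<^bsub>?M\<^esub> = cls {#}" and zero: "{#} \<in> free_ab X"
    by (simp_all add: pres_monoid_def free_ab_def cls_def)
  have add: "a + b \<in> free_ab X" if "a \<in> free_ab X" "b \<in> free_ab X" for a b
    using that by (simp add: free_ab_def)
  show ?thesis
    by (rule comm_monoidI) (auto simp: carrier mult one zero add ac_simps)
qed

section \<open>The graph monoid\<close>

text \<open>\<open>Vert v\<close> stands for the generator \<open>v\<close> and \<open>Quot Z\<close> for \<open>q'\<^sub>Z\<close>. As \<open>Z\<close> is nonempty, it
  determines the vertex \<open>v\<close> with \<open>Z \<subseteq> s\<inverse>(v)\<close>. The set \<open>s\<inverse>(v)\<close> is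
  \<^const>\<open>out_arcs\<close>\<open> E v\<close>.\<close>

datatype ('v, 'e) gm_gen = Vert 'v | Quot "'e set"

definition gm_gens :: "('v, 'e) pre_digraph \<Rightarrow> ('v, 'e) gm_gen set" where
  "gm_gens E = Vert ` verts E \<union>
    {Quot Z | Z v. v \<in> verts E \<and> Z \<subseteq> out_arcs E v \<and> finite Z \<and> Z \<noteq> {}}"

definition range_sum :: "('v, 'e) pre_digraph \<Rightarrow> 'e set \<Rightarrow> ('v, 'e) gm_gen multiset" where
  "range_sum E Y = (\<Sum>e\<in>Y. {#Vert (head E e)#})"

inductive_set gm_rels :: "('v, 'e) pre_digraph \<Rightarrow> (('v, 'e) gm_gen multiset \<times> ('v, 'e) gm_gen multiset) set"
  for E :: "('v, 'e) pre_digraph"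
where
  vertex: "\<lbrakk>v \<in> verts E; Z \<subseteq> out_arcs E v; finite Z; Z \<noteq> {}\<rbrakk> \<Longrightarrow>
    ({#Vert v#}, range_sum E Z + {#Quot Z#}) \<in> gm_rels E"
| subset: "\<lbrakk>v \<in> verts E; Z\<^sub>1 \<noteq> {}; Z\<^sub>1 \<subset> Z\<^sub>2; Z\<^sub>2 \<subseteq> out_arcs E v; finite Z\<^sub>2\<rbrakk> \<Longrightarrow>
    ({#Quot Z\<^sub>1#}, range_sum E (Z\<^sub>2 - Z\<^sub>1) + {#Quot Z\<^sub>2#}) \<in> gm_rels E"
| regular: "\<lbrakk>v \<in> verts E; finite (out_arcs E v); out_arcs E v \<noteq> {}\<rbrakk> \<Longrightarrow>
    ({#Quot (out_arcs E v)#}, {#}) \<in> gm_rels E"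

definition graph_monoid :: "('v, 'e) pre_digraph \<Rightarrow> ('v, 'e) gm_gen multiset set monoid" where
  "graph_monoid E = pres_monoid (gm_gens E) (gm_rels E)"

text \<open>The relations involve generators only, so the side conditions in
  \<open>pres_cong.base\<close> above discard none of them.\<close>

lemma gm_rels_free:
  assumes "wf_digraph E" "(a, b) \<in> gm_rels E"
  shows "a \<in> free_ab (gm_gens E) \<and> b \<in> free_ab (gm_gens E)"
proof -
  have rs: "set_mset (range_sum E Y) \<subseteq> gm_gens E"
    if "finite Y" "Y \<subseteq> out_arcs E v" for Y v
    using that wf_digraph.head_in_verts[OF assms(1)]
    by (induction Y rule: finite_induct) (auto simp: range_sum_def gm_gens_def)
  show ?thesis
    using assms(2)
  proof cases
    case (vertex v Z)
    then show ?thesis using rs[of Z v] by (auto simp: free_ab_def gm_gens_def)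
  next
    case (subset v Z\<^sub>1 Z\<^sub>2)
    then have "finite Z\<^sub>1" "Z\<^sub>1 \<subseteq> out_arcs E v" "Z\<^sub>2 \<noteq> {}"
      by (auto intro: finite_subset)
    then show ?thesis using subset rs[of "Z\<^sub>2 - Z\<^sub>1" v]
      by (auto simp: free_ab_def gm_gens_def)
  next
    case (regular v)
    then show ?thesis by (auto simp: free_ab_def gm_gens_def)
  qed
qed

end

theory Submission
  imports Defs "HOL-Library.Confluence"
begin

text \<open>
  Each defining relation of the graph monoid has a single generator on its left-hand side, so it
  may be read from left to right as a rule replacing that generator by a multiset. This makes the
  monoid the quotient of a free abelian monoid by the equivalence generated by rewriting, and
  refinement comes from two facts about that rewriting.

  A rule with one generator on the left touches only one summand of a sum. Hence a reduct of
  \<open>a + b\<close> is a sum of a reduct of \<open>a\<close> and a reduct of \<open>b\<close>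
  (\<open>rewrite_steps_split\<close>).

  Rewriting is confluent, so two congruent multisets have a common reduct
  (\<open>pres_cong_imp_common_reduct\<close>). To see this, write \<open>q'\<^sub>\<emptyset>\<close> for
  a vertex \<open>v\<close>. The first two families of rules become one, namely
  \<open>q'\<^sub>Z \<rightarrow> \<^bold>r(A - Z) + q'\<^sub>A\<close> for finite sets \<open>Z \<subset> A\<close> of arcs leaving
  \<open>v\<close>, and after two such steps towards \<open>A\<close> and \<open>B\<close> the results meet at the
  step towards \<open>A \<union> B\<close>, each side needing at most one further step
  (\<open>gm_rels_critical_pair\<close>). The remaining rule \<open>q'\<^sub>Z \<rightarrow> 0\<close> applies only if
  \<open>Z\<close> is the set of all arcs leaving \<open>v\<close>, and then no larger \<open>A\<close> exists.

  Now let \<open>a + b\<close> and \<open>c + d\<close> be congruent, with common reduct \<open>w\<close>. Splitting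
  the two rewritings gives \<open>w = a' + b' = c' + d'\<close>, where \<open>a'\<close> is congruent to
  \<open>a\<close> and so on. The free abelian monoid has refinement, so \<open>a' + b' = c' + d'\<close> can
  be refined there, and the classes of the four pieces refine the original equation
  (\<open>refinement_monoid_pres_monoid\<close>).
\<close>

section \<open>Rewriting multisets of generators\<close>

definition rewrite_step :: "('g multiset \<times> 'g multiset) set \<Rightarrow> 'g multiset \<Rightarrow> 'g multiset \<Rightarrow> bool" where
  "rewrite_step R a b \<longleftrightarrow> (\<exists>l r c. (l, r) \<in> R \<and> a = l + c \<and> b = r + c)"

lemma rewrite_step_rule: "(l, r) \<in> R \<Longrightarrow> rewrite_step R l r"
  unfolding rewrite_step_def by (metis add_0_right)

lemma rewrite_step_add: "rewrite_step R a b \<Longrightarrow> rewrite_step R (a + c) (b + c)"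
  unfolding rewrite_step_def by (metis add.assoc)

lemma rewrite_step_reflcl_add:
  "(rewrite_step R)\<^sup>=\<^sup>= a b \<Longrightarrow> (rewrite_step R)\<^sup>=\<^sup>= (a + c) (b + c)"
  using rewrite_step_add by fastforce

lemma rewrite_steps_add_right:
  "(rewrite_step R)\<^sup>*\<^sup>* a b \<Longrightarrow> (rewrite_step R)\<^sup>*\<^sup>* (a + c) (b + c)"
  by (induction rule: rtranclp_induct) (auto intro: rtranclp.rtrancl_into_rtrancl rewrite_step_add)

lemma rewrite_steps_add:
  assumes "(rewrite_step R)\<^sup>*\<^sup>* a b" "(rewrite_step R)\<^sup>*\<^sup>* c d"
  shows "(rewrite_step R)\<^sup>*\<^sup>* (a + c) (b + d)"
proof -
  have "(rewrite_step R)\<^sup>*\<^sup>* (a + c) (b + c)"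
    by (rule rewrite_steps_add_right[OF assms(1)])
  also have "(rewrite_step R)\<^sup>*\<^sup>* (b + c) (b + d)"
    using rewrite_steps_add_right[OF assms(2), of b] by (simp add: add.commute)
  finally show ?thesis .
qed

lemma rewrite_step_pres_cong:
  assumes free: "\<And>l r. (l, r) \<in> R \<Longrightarrow> l \<in> free_ab X \<and> r \<in> free_ab X"
    and "rewrite_step R a b" "a \<in> free_ab X"
  shows "(a, b) \<in> pres_cong X R"
proof -
  from assms(2) obtain l r c where c: "(l, r) \<in> R" "a = l + c" "b = r + c"
    unfolding rewrite_step_def by blast
  then have "c \<in> free_ab X"
    using assms(3) by (simp add: free_ab_def)
  then show ?thesis
    using c free by (auto intro: pres_cong.intros)
qed

lemma rewrite_steps_pres_cong:
  assumes free: "\<And>l r. (l, r) \<in> R \<Longrightarrow> l \<in> free_ab X \<and> r \<in> free_ab X"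
    and "(rewrite_step R)\<^sup>*\<^sup>* a b" "a \<in> free_ab X"
  shows "(a, b) \<in> pres_cong X R"
  using assms(2)
proof (induction rule: rtranclp_induct)
  case base
  then show ?case using assms(3) by (rule pres_cong.refl)
next
  case (step b c)
  then show ?case
    using rewrite_step_pres_cong[OF free] pres_cong_free pres_cong.trans by metis
qed

text \<open>Having a common reduct is a reflexive and symmetric relation that is compatible with
  addition and contains the rules; confluence is what makes it transitive.\<close>

lemma pres_cong_imp_common_reduct:
  assumes confl: "confluentp (rewrite_step R)" and "(a, b) \<in> pres_cong X R"
  shows "\<exists>w. (rewrite_step R)\<^sup>*\<^sup>* a w \<and> (rewrite_step R)\<^sup>*\<^sup>* b w"
  using assms(2)
proof (induction rule: pres_cong.induct)
  case (base a b)
  then show ?case by (meson r_into_rtranclp rewrite_step_rule rtranclp.rtrancl_refl)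
next
  case (trans a b c)
  then obtain w w' where w: "(rewrite_step R)\<^sup>*\<^sup>* a w" "(rewrite_step R)\<^sup>*\<^sup>* b w"
    "(rewrite_step R)\<^sup>*\<^sup>* b w'" "(rewrite_step R)\<^sup>*\<^sup>* c w'"
    by blast
  then show ?case
    using confluentpD[OF confl w(2,3)] by (meson rtranclp_trans)
next
  case (add a b c d)
  then show ?case using rewrite_steps_add by meson
qed auto

section \<open>Rules with a single generator on the left\<close>

locale single_generator_rules =
  fixes R :: "('g multiset \<times> 'g multiset) set"
  assumes single: "(l, r) \<in> R \<Longrightarrow> \<exists>g. l = {#g#}"
begin

lemma rewrite_stepE:
  assumes "rewrite_step R a b"
  obtains g r c where "({#g#}, r) \<in> R" "a = {#g#} + c" "b = r + c"
proof -
  from assms obtain l r c where "(l, r) \<in> R" "a = l + c" "b = r + c"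
    unfolding rewrite_step_def by (elim exE conjE)
  with single[of l r] that show thesis by auto
qed

text \<open>The one generator that is replaced belongs to \<open>a\<close> or to \<open>b\<close>; the other summand
  stays as it is, which is why the conclusion allows zero steps.\<close>

lemma rewrite_step_split:
  assumes "rewrite_step R (a + b) w"
  shows "\<exists>a' b'. w = a' + b' \<and> (rewrite_step R)\<^sup>=\<^sup>= a a' \<and> (rewrite_step R)\<^sup>=\<^sup>= b b'"
proof -
  from assms obtain g r c where c: "({#g#}, r) \<in> R" "a + b = {#g#} + c" "w = r + c"
    by (rule rewrite_stepE)
  have "g \<in># a + b"
    unfolding c(2) by simp
  then have "g \<in># a \<or> g \<in># b"
    by simp
  then show ?thesis
  proof
    assume "g \<in># a"
    then obtain a0 where a0: "a = add_mset g a0"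
      by (rule mset_add)
    then have "w = (r + a0) + b"
      using c by (simp add: add.assoc)
    moreover have "(rewrite_step R)\<^sup>=\<^sup>= a (r + a0)"
      using rewrite_step_add[OF rewrite_step_rule[OF c(1)], of a0] a0 by simp
    ultimately show ?thesis by (intro exI conjI) auto
  next
    assume "g \<in># b"
    then obtain b0 where b0: "b = add_mset g b0"
      by (rule mset_add)
    then have "w = a + (r + b0)"
      using c by (simp add: ac_simps)
    moreover have "(rewrite_step R)\<^sup>=\<^sup>= b (r + b0)"
      using rewrite_step_add[OF rewrite_step_rule[OF c(1)], of b0] b0 by simp
    ultimately show ?thesis by (intro exI conjI) auto
  qed
qed

lemma rewrite_steps_split:
  assumes "(rewrite_step R)\<^sup>*\<^sup>* (a + b) w"
  shows "\<exists>a' b'. w = a' + b' \<and> (rewrite_step R)\<^sup>*\<^sup>* a a' \<and> (rewrite_step R)\<^sup>*\<^sup>* b b'"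
  using assms
proof (induction rule: rtranclp_induct)
  case base
  then show ?case by blast
next
  case (step v w)
  then obtain a' b' where v: "v = a' + b'"
    "(rewrite_step R)\<^sup>*\<^sup>* a a'" "(rewrite_step R)\<^sup>*\<^sup>* b b'"
    by blast
  with rewrite_step_split[of a' b' w] step.hyps(2) obtain a'' b''
    where "w = a'' + b''" "(rewrite_step R)\<^sup>=\<^sup>= a' a''" "(rewrite_step R)\<^sup>=\<^sup>= b' b''"
    by blast
  moreover from this v have "(rewrite_step R)\<^sup>*\<^sup>* a a''" "(rewrite_step R)\<^sup>*\<^sup>* b b''"
    by (auto intro: rtranclp.rtrancl_into_rtrancl)
  ultimately show ?case by blast
qed

text \<open>Steps at different generators do not interfere and can be done in either order. Steps at the
  same generator leave the same rest, because a multiset does not tell its equal members apart, so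
  it suffices that the right-hand sides of rules for one generator can be joined. Allowing at most
  one step on either side gives strong confluence, which implies confluence without any termination
  argument.\<close>

lemma rewrite_step_diamond:
  assumes critical: "\<And>g u v. \<lbrakk>({#g#}, u) \<in> R; ({#g#}, v) \<in> R\<rbrakk> \<Longrightarrow>
      \<exists>w. (rewrite_step R)\<^sup>=\<^sup>= u w \<and> (rewrite_step R)\<^sup>=\<^sup>= v w"
    and "rewrite_step R a b" "rewrite_step R a c"
  shows "\<exists>w. (rewrite_step R)\<^sup>=\<^sup>= b w \<and> (rewrite_step R)\<^sup>=\<^sup>= c w"
proof -
  obtain g u p where p: "({#g#}, u) \<in> R" "a = {#g#} + p" "b = u + p"
    using assms(2) by (rule rewrite_stepE)
  obtain h v q where q: "({#h#}, v) \<in> R" "a = {#h#} + q" "c = v + q"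
    using assms(3) by (rule rewrite_stepE)
  show ?thesis
  proof (cases "g = h")
    case True
    then have "p = q" using p q by simp
    obtain w where "(rewrite_step R)\<^sup>=\<^sup>= u w" "(rewrite_step R)\<^sup>=\<^sup>= v w"
      using critical[of g u v] p(1) q(1) True by auto
    then have "(rewrite_step R)\<^sup>=\<^sup>= b (w + p)" "(rewrite_step R)\<^sup>=\<^sup>= c (w + p)"
      using rewrite_step_reflcl_add[of R _ w p] p(3) q(3) \<open>p = q\<close> by blast+
    then show ?thesis by blast
  next
    case False
    then obtain k where k: "p = {#h#} + k" "q = {#g#} + k"
      using p(2) q(2) by (auto simp: add_eq_conv_ex)
    have "(rewrite_step R)\<^sup>=\<^sup>= b (v + (u + k))"
      using rewrite_step_add[OF rewrite_step_rule[OF q(1)], of "u + k"] p(3) k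
      by (simp add: ac_simps)
    moreover have "(rewrite_step R)\<^sup>=\<^sup>= c (v + (u + k))"
      using rewrite_step_add[OF rewrite_step_rule[OF p(1)], of "v + k"] q(3) k
      by (simp add: ac_simps)
    ultimately show ?thesis by blast
  qed
qed

lemma confluentp_rewrite_step:
  assumes critical: "\<And>g u v. \<lbrakk>({#g#}, u) \<in> R; ({#g#}, v) \<in> R\<rbrakk> \<Longrightarrow>
      \<exists>w. (rewrite_step R)\<^sup>=\<^sup>= u w \<and> (rewrite_step R)\<^sup>=\<^sup>= v w"
  shows "confluentp (rewrite_step R)"
proof (rule strong_confluentp_imp_confluentp, rule strong_confluentpI)
  fix a b c
  assume steps: "rewrite_step R a b" "rewrite_step R a c"
  have "\<exists>w. (rewrite_step R)\<^sup>=\<^sup>= b w \<and> (rewrite_step R)\<^sup>=\<^sup>= c w"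
    by (rule rewrite_step_diamond[OF _ steps]) (rule critical)
  moreover have "(rewrite_step R)\<^sup>*\<^sup>* b w" if "(rewrite_step R)\<^sup>=\<^sup>= b w" for w
    using that by auto
  ultimately show "\<exists>w. (rewrite_step R)\<^sup>*\<^sup>* b w \<and> (rewrite_step R)\<^sup>=\<^sup>= c w"
    by meson
qed

end

section \<open>Refinement from confluence\<close>

lemma multiset_refinement:
  fixes a b c d :: "'g multiset"
  assumes "a + b = c + d"
  shows "\<exists>x y z t. a = x + y \<and> b = z + t \<and> c = x + z \<and> d = y + t"
proof (intro exI conjI)
  have count: "count a i + count b i = count c i + count d i" for i
    using assms by (metis count_union)
  \<comment> \<open>The common part of \<open>a\<close> and \<open>c\<close> is made as large as possible.\<close>
  show "a = a \<inter># c + (a - c)" "c = a \<inter># c + (c - a)"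
    by (auto intro!: multiset_eqI)
  show "b = (c - a) + (b \<inter># d)"
  proof (rule multiset_eqI)
    show "count b i = count ((c - a) + (b \<inter># d)) i" for i
      using count[of i] by simp
  qed
  show "d = (a - c) + (b \<inter># d)"
  proof (rule multiset_eqI)
    show "count d i = count ((a - c) + (b \<inter># d)) i" for i
      using count[of i] by simp
  qed
qed

theorem (in single_generator_rules) refinement_monoid_pres_monoid:
  assumes free: "\<And>l r. (l, r) \<in> R \<Longrightarrow> l \<in> free_ab X \<and> r \<in> free_ab X"
    and confl: "confluentp (rewrite_step R)"
  shows "refinement_monoid (pres_monoid X R)"
proof -
  let ?M = "pres_monoid X R"
  define cls where "cls a = pres_cong X R `` {a}" for a
  interpret comm_monoid ?M
    by (rule comm_monoid_pres_monoid)
  have carrier: "carrier ?M = cls ` free_ab X"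
    by (auto simp: pres_monoid_def quotient_def cls_def)
  have mult: "cls a \<otimes>\<^bsub>?M\<^esub> cls b = cls (a + b)" if "a \<in> free_ab X" "b \<in> free_ab X" for a b
    using that by (simp add: cls_def pres_monoid_mult_class)
  have free_add: "a + b \<in> free_ab X \<longleftrightarrow> a \<in> free_ab X \<and> b \<in> free_ab X" for a b
    by (simp add: free_ab_def)
  have reduct: "w \<in> free_ab X \<and> cls w = cls a"
    if "(rewrite_step R)\<^sup>*\<^sup>* a w" "a \<in> free_ab X" for a w
    using rewrite_steps_pres_cong[OF free that] pres_cong_free[of a w X R]
      equiv_class_eq[OF equiv_pres_cong, of a w X R] by (simp add: cls_def)
  show ?thesis
  proof unfold_locales
    fix A B C D
    assume "A \<in> carrier ?M" "B \<in> carrier ?M" "C \<in> carrier ?M" "D \<in> carrier ?M"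
      and eq: "A \<otimes>\<^bsub>?M\<^esub> B = C \<otimes>\<^bsub>?M\<^esub> D"
    then obtain a b c d where abcd: "A = cls a" "B = cls b" "C = cls c" "D = cls d"
      and fr: "a \<in> free_ab X" "b \<in> free_ab X" "c \<in> free_ab X" "d \<in> free_ab X"
      unfolding carrier by blast
    have "cls (a + b) = cls (c + d)"
      using eq abcd fr mult by simp
    then have "(a + b, c + d) \<in> pres_cong X R"
      using eq_equiv_class_iff[OF equiv_pres_cong] fr free_add unfolding cls_def by blast
    then obtain w where "(rewrite_step R)\<^sup>*\<^sup>* (a + b) w" "(rewrite_step R)\<^sup>*\<^sup>* (c + d) w"
      using pres_cong_imp_common_reduct[OF confl] by blast
    then obtain a' b' c' d' where w: "w = a' + b'" "w = c' + d'"
      and steps: "(rewrite_step R)\<^sup>*\<^sup>* a a'" "(rewrite_step R)\<^sup>*\<^sup>* b b'"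
        "(rewrite_step R)\<^sup>*\<^sup>* c c'" "(rewrite_step R)\<^sup>*\<^sup>* d d'"
      using rewrite_steps_split by metis
    obtain x y z t where xyzt: "a' = x + y" "b' = z + t" "c' = x + z" "d' = y + t"
      using multiset_refinement[of a' b' c' d'] w by auto
    have red: "a' \<in> free_ab X" "cls a' = A" "b' \<in> free_ab X" "cls b' = B"
      "cls c' = C" "cls d' = D"
      using reduct steps fr abcd by auto
    then have xyzt_free: "x \<in> free_ab X" "y \<in> free_ab X" "z \<in> free_ab X" "t \<in> free_ab X"
      using xyzt free_add by auto
    have "A = cls x \<otimes>\<^bsub>?M\<^esub> cls y" "B = cls z \<otimes>\<^bsub>?M\<^esub> cls t"
      "C = cls x \<otimes>\<^bsub>?M\<^esub> cls z" "D = cls y \<otimes>\<^bsub>?M\<^esub> cls t"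
      using red xyzt xyzt_free mult by auto
    then show "\<exists>x\<in>carrier ?M. \<exists>y\<in>carrier ?M. \<exists>z\<in>carrier ?M. \<exists>t\<in>carrier ?M.
        A = x \<otimes>\<^bsub>?M\<^esub> y \<and> B = z \<otimes>\<^bsub>?M\<^esub> t \<and> C = x \<otimes>\<^bsub>?M\<^esub> z \<and> D = y \<otimes>\<^bsub>?M\<^esub> t"
      using xyzt_free unfolding carrier by blast
  qed
qed

section \<open>The rules of the graph monoid\<close>

interpretation gm: single_generator_rules "gm_rels E"
  by unfold_locales (auto elim: gm_rels.cases)

lemma range_sum_split:
  assumes "finite C" "A \<subseteq> C"
  shows "range_sum E C = range_sum E A + range_sum E (C - A)"
  unfolding range_sum_def using sum.subset_diff[OF assms(2,1)] by (simp add: add.commute)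

text \<open>The case \<open>Z = {}\<close> is included, where \<open>\<^bold>r(A - Z) + q'\<^sub>A\<close> is the right-hand side of
  a rule for a vertex. This lets \<open>quot_extensions_join\<close> treat rules for vertices and rules for
  the generators \<open>q'\<^sub>Z\<close> together.\<close>

lemma quot_step_to_superset:
  assumes "v \<in> verts E" "A \<noteq> {}" "Z \<subseteq> A" "A \<subseteq> C" "C \<subseteq> out_arcs E v" "finite C"
  shows "(rewrite_step (gm_rels E))\<^sup>=\<^sup>=
    (range_sum E (A - Z) + {#Quot A#}) (range_sum E (C - Z) + {#Quot C#})"
proof (cases "A = C")
  case False
  with assms have "({#Quot A#}, range_sum E (C - A) + {#Quot C#}) \<in> gm_rels E"
    by (intro gm_rels.subset) auto
  moreover have "range_sum E (C - Z) = range_sum E (A - Z) + range_sum E (C - A)"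
  proof -
    have "C - Z - (A - Z) = C - A" "A - Z \<subseteq> C - Z"
      using assms by auto
    then show ?thesis
      using range_sum_split[of "C - Z" "A - Z" E] assms by simp
  qed
  ultimately show ?thesis
    using rewrite_step_add[OF rewrite_step_rule, of "{#Quot A#}"
        "range_sum E (C - A) + {#Quot C#}" "gm_rels E" "range_sum E (A - Z)"]
    by (simp add: ac_simps)
qed simp

lemma quot_extensions_join:
  assumes "v \<in> verts E" "A \<noteq> {}" "Z \<subseteq> A" "A \<subseteq> out_arcs E v" "finite A"
    and "B \<noteq> {}" "Z \<subseteq> B" "B \<subseteq> out_arcs E v" "finite B"
  shows "\<exists>w. (rewrite_step (gm_rels E))\<^sup>=\<^sup>= (range_sum E (A - Z) + {#Quot A#}) w \<and>
    (rewrite_step (gm_rels E))\<^sup>=\<^sup>= (range_sum E (B - Z) + {#Quot B#}) w"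
proof (intro exI conjI)
  let ?w = "range_sum E (A \<union> B - Z) + {#Quot (A \<union> B)#}"
  show "(rewrite_step (gm_rels E))\<^sup>=\<^sup>= (range_sum E (A - Z) + {#Quot A#}) ?w"
    using assms by (intro quot_step_to_superset[of v]) auto
  show "(rewrite_step (gm_rels E))\<^sup>=\<^sup>= (range_sum E (B - Z) + {#Quot B#}) ?w"
    using assms by (intro quot_step_to_superset[of v]) auto
qed

lemma out_arcs_vertex_unique:
  assumes "Z \<noteq> {}" "Z \<subseteq> out_arcs E v" "Z \<subseteq> out_arcs E w"
  shows "v = w"
proof -
  from assms(1) obtain e where "e \<in> Z"
    by blast
  then have "e \<in> out_arcs E v" "e \<in> out_arcs E w"
    using assms(2,3) by auto
  then show ?thesis
    by simp
qed

lemma gm_rels_critical_pair: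
  assumes "({#g#}, a) \<in> gm_rels E" "({#g#}, b) \<in> gm_rels E"
  shows "\<exists>w. (rewrite_step (gm_rels E))\<^sup>=\<^sup>= a w \<and> (rewrite_step (gm_rels E))\<^sup>=\<^sup>= b w"
  using assms(1)
proof cases
  case (vertex v A)
  from assms(2) show ?thesis
  proof cases
    case (vertex v' B)
    then show ?thesis
      using quot_extensions_join[of v E A "{}" B] \<open>{#g#} = {#Vert v#}\<close> \<open>v \<in> verts E\<close>
        \<open>A \<subseteq> out_arcs E v\<close> \<open>finite A\<close> \<open>A \<noteq> {}\<close> \<open>a = range_sum E A + {#Quot A#}\<close> by simp
  qed (use vertex in auto)
next
  case subset_A: (subset v Z A)
  from assms(2) show ?thesis
  proof cases
    case (subset v' Z' B)
    with subset_A have "Z' = Z" "v' = v"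
      using out_arcs_vertex_unique[of Z E v' v] by auto
    with subset subset_A show ?thesis
      using quot_extensions_join[of v E A Z B] by auto
  next
    case (regular v')
    with subset_A have "Z = out_arcs E v'" "v' = v"
      using out_arcs_vertex_unique[of Z E v' v] by auto
    with subset_A show ?thesis by blast
  qed (use subset_A in auto)
next
  case regular_v: (regular v)
  from assms(2) show ?thesis
  proof cases
    case (subset v' Z B)
    with regular_v have "Z = out_arcs E v" "v' = v"
      using out_arcs_vertex_unique[of Z E v' v] by auto
    with subset show ?thesis by blast
  next
    case (regular v')
    with regular_v show ?thesis by auto
  qed (use regular_v in auto)
qed

theorem corollary5p16:
  fixes E :: "('v, 'e) pre_digraph"
  assumes "wf_digraph E" and "verts E \<noteq> {}"
  shows "refinement_monoid (graph_monoid E)"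
  unfolding graph_monoid_def
proof (rule gm.refinement_monoid_pres_monoid)
  show "l \<in> free_ab (gm_gens E) \<and> r \<in> free_ab (gm_gens E)" if "(l, r) \<in> gm_rels E" for l r
    using gm_rels_free assms(1) that .
  show "confluentp (rewrite_step (gm_rels E))"
    by (rule gm.confluentp_rewrite_step) (rule gm_rels_critical_pair)
qed

end
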